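(* Let $\beta\in[0,1]$. If $f\in\mathcal{A}_\beta$ has the form $f(z)=z+\sum_{n=2}^\infty a_n z^n$, then $$T_{3,1}(f)\le \begin{cases}\dfrac{4\beta^4-28\beta^3+37\beta^2-4\beta-4}{(3-2\beta)^2(2-\beta)^2}, & \frac{10-\sqrt{10}}{9}\le\beta\le 1,\\[2mm] 1, & 0\le\beta\le\frac{10-\sqrt{10}}{9}.\end{cases}$$ The bounds are sharp.
   Context: $\mathbb{D}=\{z\in\mathbb{C}:|z|<1\}$. $\mathcal{A}$ is the class of holomorphic functions $f$ on $\mathbb{D}$ of the form $f(z)=z+\sum_{n=2}^\infty a_n z^n$. For $\beta\in[0,1]$, $\mathcal{A}_\beta=\{f\in\mathcal{A}:\operatorname{Re}(\beta \frac{f(z)}{z}+(1-\beta)f'(z))>0 \text{ for all } z\in\mathbb{D}\}$, where $f(z)/z$ takes the value $1$ at $z=0$. The third order Hermitian-Toeplitz determinant is $T_{3,1}(f)=\begin{vmatrix}1&a_2&a_3\\ \overline{a_2}&1&a_2\\ \overline{a_3}&\overline{a_2}&1\end{vmatrix}=1-2|a_2|^2+2\operatorname{Re}(a_2^2\overline{a_3})-|a_3|^2$. A bound being sharp means that equality is attained for some $f\in\mathcal{A}_\beta$. *)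

theory Defs
  imports "HOL-Complex_Analysis.Complex_Analysis"
begin

abbreviation unit_disc :: "complex set" where
  "unit_disc \<equiv> ball 0 1"

definition taylor_coeff :: "(complex \<Rightarrow> complex) \<Rightarrow> nat \<Rightarrow> complex" where
  "taylor_coeff f n = (deriv ^^ n) f 0 / fact n"

(* Functions are total in HOL; membership in class_A depends only on the values in the disc. *)
definition class_A :: "(complex \<Rightarrow> complex) set" where
  "class_A = {f. f holomorphic_on unit_disc \<and>
     (\<exists>a :: nat \<Rightarrow> complex. \<forall>z\<in>unit_disc. (\<lambda>n. a (n + 2) * z ^ (n + 2)) sums (f z - z))}"

definition class_A_beta :: "real \<Rightarrow> (complex \<Rightarrow> complex) set" where
  "class_A_beta \<beta> = {f \<in> class_A. \<forall>z\<in>unit_disc.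
     Re (of_real \<beta> * (if z = 0 then 1 else f z / z) + of_real (1 - \<beta>) * deriv f z) > 0}"

definition hermitian_toeplitz_3 :: "complex \<Rightarrow> complex \<Rightarrow> complex ^ 3 ^ 3" where
  "hermitian_toeplitz_3 a2 a3 = vector
     [vector [1,      a2,     a3],
      vector [cnj a2, 1,      a2],
      vector [cnj a3, cnj a2, 1 ]]"

(* The determinant is real (see hermitian_toeplitz_3_det), so Re only changes its type. *)
definition T31 :: "(complex \<Rightarrow> complex) \<Rightarrow> real" where
  "T31 f = Re (det (hermitian_toeplitz_3 (taylor_coeff f 2) (taylor_coeff f 3)))"

lemma hermitian_toeplitz_3_det:
  "det (hermitian_toeplitz_3 a2 a3) =
     of_real (1 - 2 * (cmod a2)\<^sup>2 + 2 * Re (a2\<^sup>2 * cnj a3) - (cmod a3)\<^sup>2)"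
  unfolding cmod_power2
  by (auto simp: hermitian_toeplitz_3_def det_3 complex_eq_iff power2_eq_square algebra_simps)

lemma T31_eq:
  "T31 f = 1 - 2 * (cmod (taylor_coeff f 2))\<^sup>2
     + 2 * Re ((taylor_coeff f 2)\<^sup>2 * cnj (taylor_coeff f 3)) - (cmod (taylor_coeff f 3))\<^sup>2"
  by (simp add: T31_def hermitian_toeplitz_3_det)

(* The coefficients in the expansion of a member of class_A are its Taylor coefficients. *)
lemma taylor_coeff_unique:
  assumes "\<forall>z\<in>unit_disc. (\<lambda>n. a (n + 2) * z ^ (n + 2)) sums (f z - z)" and "n \<ge> 2"
  shows "taylor_coeff f n = a n"
proof -
  define b where "b n = (if n = 0 then 0 else if n = 1 then 1 else a n)" for n
  have b: "(\<lambda>n. b n * z ^ n) sums f z" if "z \<in> unit_disc" for z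
  proof -
    have "(\<lambda>n. b (n + 2) * z ^ (n + 2)) sums (f z - z)"
      using assms(1) that by (simp add: b_def)
    then have "(\<lambda>n. b n * z ^ n) sums (f z - z + (\<Sum>i<2. b i * z ^ i))"
      by (rule iffD1[OF sums_iff_shift])
    then show ?thesis
      by (simp add: b_def numeral_2_eq_2)
  qed
  have "eventually (\<lambda>z. z \<in> unit_disc) (nhds 0)"
    by (rule eventually_nhds_in_open) auto
  then have "f has_fps_expansion Abs_fps b"
    by (intro has_fps_expansionI) (auto elim!: eventually_mono intro!: b)
  then have "fps_nth (Abs_fps b) n = (deriv ^^ n) f 0 / fact n"
    by (rule fps_nth_fps_expansion)
  then show ?thesis
    using assms(2) by (simp add: taylor_coeff_def b_def)
qed

end

theory Submission
  imports Defs
begin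

text \<open>
  The determinant is a difference of two squares,
  \<open>(1 - |a\<^sub>2|\<^sup>2)\<^sup>2 - |a\<^sub>3 - a\<^sub>2\<^sup>2|\<^sup>2\<close>, so an upper bound only needs a lower bound for
  \<open>|a\<^sub>3 - a\<^sub>2\<^sup>2|\<close> in terms of \<open>|a\<^sub>2|\<close>.

  The function \<open>p(z) = \<beta> f(z)/z + (1 - \<beta>) f'(z) = 1 + c\<^sub>1 z + c\<^sub>2 z\<^sup>2 + ...\<close> has positive real
  part, and with \<open>m = 2 - \<beta>\<close> and \<open>n = 3 - 2 \<beta>\<close> one has \<open>a\<^sub>2 = c\<^sub>1 / m\<close> and \<open>a\<^sub>3 = c\<^sub>2 / n\<close>. The
  sharp Caratheodory inequality \<open>|c\<^sub>2 - c\<^sub>1\<^sup>2/2| \<le> 2 - |c\<^sub>1|\<^sup>2/2\<close> places \<open>a\<^sub>3\<close> in a disc about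
  \<open>c\<^sub>1\<^sup>2/(2n)\<close>, and the triangle inequality turns this into
  \<open>|a\<^sub>3 - a\<^sub>2\<^sup>2| \<ge> y - 2/n\<close>, where \<open>y = |a\<^sub>2|\<^sup>2\<close> runs through \<open>[0, 4/m\<^sup>2]\<close>.

  Hence the determinant is at most \<open>(1 - y)\<^sup>2\<close> while \<open>y \<le> 2/n\<close>, and at most
  \<open>(1 - y)\<^sup>2 - (y - 2/n)\<^sup>2\<close> beyond that point. The first expression is convex and the second is
  linear in \<open>y\<close>, so the maximum sits at an end point; the value at the junction \<open>y = 2/n\<close> is
  \<open>(1 - 2/n)\<^sup>2 \<le> 1\<close>, so what remains is \<open>1\<close> (at \<open>y = 0\<close>) or the value \<open>V\<close> at \<open>y = 4/m\<^sup>2\<close>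
  (lemma \<open>T31_le_max\<close>). Both are attained: at \<open>y = 0\<close> by \<open>f(z) = z\<close>, and at
  \<open>y = 4/m\<^sup>2\<close> by the function whose \<open>p\<close> is the half-plane map \<open>(1 + z)/(1 - z)\<close>.
  Finally, \<open>V - 1\<close> has the sign of a quadratic in \<open>\<beta>\<close> with roots \<open>(10 \<plusminus> sqrt 10)/9\<close>, of which
  only the smaller lies in \<open>[0,1]\<close>; this is where the two cases meet.
\<close>

section \<open>Coefficients of bounded functions and of functions with positive real part\<close>

lemma fps_expansion_unique_ev:
  fixes f g :: "complex \<Rightarrow> complex"
  assumes "eventually (\<lambda>z. f z = g z) (nhds 0)" "f has_fps_expansion F" "g has_fps_expansion G"
  shows "F = G"
proof -
  have "g has_fps_expansion F"
    using has_fps_expansion_cong[OF assms(1) refl] assms(2) by simp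
  then show ?thesis
    using assms(3) by (rule fps_expansion_unique_complex)
qed

text \<open>
  The Schwarz--Pick inequality at the origin: follow \<open>h\<close> by the disc automorphism that sends
  \<open>h 0\<close> to \<open>0\<close>, and apply the Schwarz lemma. The automorphism degenerates when \<open>|h 0| = 1\<close>, so
  functions that reach the unit circle are treated apart; by the maximum principle they are
  constant.
\<close>
lemma schwarz_pick_coefficient:
  fixes h :: "complex \<Rightarrow> complex"
  assumes hol: "h holomorphic_on ball 0 1"
    and le: "\<And>z. z \<in> ball 0 1 \<Longrightarrow> cmod (h z) \<le> 1"
    and exp: "h has_fps_expansion H"
  shows "cmod (fps_nth H 1) \<le> 1 - (cmod (fps_nth H 0))\<^sup>2"
proof -
  have H0: "fps_nth H 0 = h 0"
    using fps_nth_fps_expansion[OF exp, of 0] by simp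
  show ?thesis
  proof (cases "\<exists>w\<in>ball 0 1. cmod (h w) = 1")
    case True
    then obtain w where w: "w \<in> ball 0 1" "cmod (h w) = 1" by blast
    have "h constant_on ball 0 1"
      by (rule maximum_modulus_principle[OF hol, of "ball 0 1" w]) (use w le in auto)
    then obtain c where c: "\<And>z. z \<in> ball 0 1 \<Longrightarrow> h z = c"
      by (auto simp: constant_on_def)
    have "eventually (\<lambda>z::complex. z \<in> ball 0 1) (nhds 0)"
      by (rule eventually_nhds_in_open) auto
    then have "eventually (\<lambda>z. h z = c) (nhds 0)"
      by (rule eventually_mono) (use c in auto)
    then have "h has_fps_expansion fps_const c"
      by (subst has_fps_expansion_cong[where g = "\<lambda>_. c"]) auto
    then have "H = fps_const c"
      using exp fps_expansion_unique_complex by blast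
    then show ?thesis
      using c[of 0] le[of 0] by (simp add: power_le_one)
  next
    case False
    then have less: "cmod (h z) < 1" if "z \<in> ball 0 1" for z
      using le[OF that] that by force
    define b where "b = h 0"
    have b: "cmod b < 1" using less[of 0] by (simp add: b_def)
    define \<phi> where "\<phi> = (\<lambda>z. Moebius_function 0 b (h z))"
    have "(Moebius_function 0 b \<circ> h) holomorphic_on ball 0 1"
      by (rule holomorphic_on_compose_gen[OF hol Moebius_function_holomorphic[OF b]])
         (use less in auto)
    then have hol\<phi>: "\<phi> holomorphic_on ball 0 1"
      by (simp add: \<phi>_def o_def)
    have \<phi>0: "\<phi> 0 = 0"
      by (simp add: \<phi>_def b_def Moebius_function_eq_zero)
    have \<phi>less: "cmod (\<phi> z) < 1" if "cmod z < 1" for z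
      unfolding \<phi>_def using b less[of z] that by (intro Moebius_function_norm_lt_1) auto
    have d: "cmod (deriv \<phi> 0) \<le> 1"
      by (rule Schwarz_Lemma(2)[OF hol\<phi> \<phi>0 \<phi>less, of 0]) auto
    define \<Phi> where "\<Phi> = fps_expansion \<phi> 0"
    have exp\<phi>: "\<phi> has_fps_expansion \<Phi>"
      unfolding \<Phi>_def by (rule has_fps_expansion_fps_expansion[OF _ _ hol\<phi>]) auto
    have \<Phi>01: "fps_nth \<Phi> 0 = 0" "fps_nth \<Phi> 1 = deriv \<phi> 0"
      using fps_nth_fps_expansion[OF exp\<phi>, of 0] fps_nth_fps_expansion[OF exp\<phi>, of 1] \<phi>0
      by simp_all
    \<comment> \<open>Clearing the denominator lets the coefficients be compared as a product of power series.\<close>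
    have "h z - b = \<phi> z * (1 - cnj b * h z)" if "z \<in> ball 0 1" for z
    proof -
      have "cmod (cnj b * h z) < 1"
        using b less[OF that] by (simp add: norm_mult_less[of _ 1 _ 1, simplified])
      then have "1 - cnj b * h z \<noteq> 0" by auto
      then show ?thesis by (simp add: \<phi>_def Moebius_function_simple)
    qed
    moreover have "eventually (\<lambda>z::complex. z \<in> ball 0 1) (nhds 0)"
      by (rule eventually_nhds_in_open) auto
    ultimately have "eventually (\<lambda>z. h z - b = \<phi> z * (1 - cnj b * h z)) (nhds 0)"
      by (auto elim!: eventually_mono)
    moreover have "(\<lambda>z. h z - b) has_fps_expansion H - fps_const b"
      by (intro fps_expansion_intros exp)
    moreover have "(\<lambda>z. \<phi> z * (1 - cnj b * h z)) has_fps_expansion \<Phi> * (1 - fps_const (cnj b) * H)"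
      by (intro fps_expansion_intros exp exp\<phi>)
    ultimately have "H - fps_const b = \<Phi> * (1 - fps_const (cnj b) * H)"
      by (rule fps_expansion_unique_ev)
    then have "fps_nth (H - fps_const b) 1 = fps_nth (\<Phi> * (1 - fps_const (cnj b) * H)) 1"
      by simp
    then have "fps_nth H 1 = deriv \<phi> 0 * (1 - cnj b * b)"
      using \<Phi>01 H0 by (simp add: fps_mult_nth b_def)
    also have "1 - cnj b * b = of_real (1 - (cmod b)\<^sup>2)"
      by (simp only: of_real_diff of_real_1 complex_norm_square mult.commute)
    finally have "cmod (fps_nth H 1) = cmod (deriv \<phi> 0) * \<bar>1 - (cmod b)\<^sup>2\<bar>"
      by (simp only: norm_mult norm_of_real)
    moreover have "(cmod b)\<^sup>2 \<le> 1" using b by (simp add: power_le_one)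
    ultimately show ?thesis
      using mult_right_mono[OF d, of "1 - (cmod b)\<^sup>2"] by (simp add: H0 b_def)
  qed
qed

text \<open>
  The Cayley transform \<open>(p - 1)/(p + 1)\<close> is a self-map of the disc that fixes \<open>0\<close>, hence of the form
  \<open>z h(z)\<close> with \<open>|h| \<le> 1\<close>. Comparing coefficients gives \<open>c\<^sub>1 = 2 h\<^sub>0\<close> and
  \<open>c\<^sub>2 - c\<^sub>1\<^sup>2/2 = 2 h\<^sub>1\<close>, so the claim is the Schwarz--Pick inequality for \<open>h\<close>.
\<close>
lemma caratheodory_second_coefficient:
  fixes p :: "complex \<Rightarrow> complex"
  assumes hol: "p holomorphic_on ball 0 1" and p0: "p 0 = 1"
    and pos: "\<And>z. z \<in> ball 0 1 \<Longrightarrow> Re (p z) > 0"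
    and exp: "p has_fps_expansion P"
  shows "cmod (fps_nth P 2 - (fps_nth P 1)\<^sup>2 / 2) \<le> 2 - (cmod (fps_nth P 1))\<^sup>2 / 2"
proof -
  define \<omega> where "\<omega> = (\<lambda>z. (p z - 1) / (p z + 1))"
  have nz: "p z + 1 \<noteq> 0" if "z \<in> ball 0 1" for z
    using pos[OF that] by (auto simp: complex_eq_iff)
  have hol\<omega>: "\<omega> holomorphic_on ball 0 1"
    unfolding \<omega>_def using nz by (intro holomorphic_intros hol) auto
  have \<omega>0: "\<omega> 0 = 0" by (simp add: \<omega>_def p0)
  have \<omega>less: "cmod (\<omega> z) < 1" if "cmod z < 1" for z
  proof -
    have z: "z \<in> ball 0 1" using that by simp
    have "(cmod (p z - 1))\<^sup>2 < (cmod (p z + 1))\<^sup>2"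
      using pos[OF z] unfolding cmod_power2 by (simp add: power2_eq_square algebra_simps)
    then have "cmod (p z - 1) < cmod (p z + 1)"
      by (rule power_less_imp_less_base) simp
    then show ?thesis using nz[OF z] by (simp add: \<omega>_def norm_divide)
  qed
  obtain h where holh: "h holomorphic_on ball 0 1"
    and \<omega>h: "\<And>z. cmod z < 1 \<Longrightarrow> \<omega> z = z * h z" and h0: "deriv \<omega> 0 = h 0"
    using Schwarz3[OF hol\<omega> \<omega>0] by blast
  have hle: "cmod (h z) \<le> 1" if "z \<in> ball 0 1" for z
  proof (cases "z = 0")
    case True
    have "cmod (deriv \<omega> 0) \<le> 1"
      by (rule Schwarz_Lemma(2)[OF hol\<omega> \<omega>0 \<omega>less, of 0]) auto
    then show ?thesis using True h0 by simp
  next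
    case False
    have "cmod (\<omega> z) \<le> cmod z"
      by (rule Schwarz_Lemma(1)[OF hol\<omega> \<omega>0 \<omega>less]) (use that in auto)
    then show ?thesis using False \<omega>h[of z] that by (simp add: norm_mult)
  qed
  define H where "H = fps_expansion h 0"
  have exph: "h has_fps_expansion H"
    unfolding H_def by (rule has_fps_expansion_fps_expansion[OF _ _ holh]) auto
  have "p z - 1 = z * h z * (p z + 1)" if "z \<in> ball 0 1" for z
    using \<omega>h[of z] nz[OF that] that by (simp add: \<omega>_def divide_simps)
  moreover have "eventually (\<lambda>z::complex. z \<in> ball 0 1) (nhds 0)"
    by (rule eventually_nhds_in_open) auto
  ultimately have "eventually (\<lambda>z. p z - 1 = z * h z * (p z + 1)) (nhds 0)"
    by (auto elim!: eventually_mono)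
  moreover have "(\<lambda>z. p z - 1) has_fps_expansion P - 1"
    by (intro fps_expansion_intros exp)
  moreover have "(\<lambda>z. z * h z * (p z + 1)) has_fps_expansion fps_X * H * (P + 1)"
    by (intro fps_expansion_intros exp exph)
  ultimately have "P - 1 = fps_X * H * (P + 1)"
    by (rule fps_expansion_unique_ev)
  then have eq: "fps_nth (P - 1) n = fps_nth (fps_X * (H * (P + 1))) n" for n
    by (simp add: mult.assoc)
  have P0: "fps_nth P 0 = 1"
    using fps_nth_fps_expansion[OF exp, of 0] p0 by simp
  have P1: "fps_nth P 1 = 2 * fps_nth H 0"
    using eq[of 1] P0 by (simp add: fps_mult_nth)
  have P2: "fps_nth P 2 = fps_nth H 0 * fps_nth P 1 + 2 * fps_nth H 1"
    using eq[of 2] P0 by (simp add: fps_mult_nth numeral_2_eq_2)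
  have eq2: "fps_nth P 2 - (fps_nth P 1)\<^sup>2 / 2 = 2 * fps_nth H 1"
    unfolding P2 P1 by (simp add: power2_eq_square)
  show ?thesis
    unfolding eq2 unfolding P1 using schwarz_pick_coefficient[OF holh hle exph]
    by (simp add: norm_mult power_mult_distrib)
qed

section \<open>The upper bound\<close>

lemma T31_difference_of_squares:
  "T31 f = (1 - (cmod (taylor_coeff f 2))\<^sup>2)\<^sup>2
     - (cmod (taylor_coeff f 3 - (taylor_coeff f 2)\<^sup>2))\<^sup>2"
  unfolding T31_eq cmod_power2
  by (simp add: power2_eq_square algebra_simps)

lemma class_A_has_fps_expansion:
  assumes "f \<in> class_A"
  obtains F where "f has_fps_expansion F" "fps_nth F 0 = 0" "fps_nth F 1 = 1"
proof -
  from assms obtain a :: "nat \<Rightarrow> complex"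
    where a: "\<And>z. z \<in> ball 0 1 \<Longrightarrow> (\<lambda>n. a (n + 2) * z ^ (n + 2)) sums (f z - z)"
    unfolding class_A_def by blast
  define F where "F = Abs_fps (\<lambda>n. if n = 0 then 0 else if n = 1 then 1 else a n)"
  have "(\<lambda>n. fps_nth F n * z ^ n) sums f z" if "z \<in> ball 0 1" for z
  proof -
    have "(\<lambda>n. fps_nth F (n + 2) * z ^ (n + 2)) sums (f z - z)"
      using a[OF that] by (simp add: F_def)
    then have "(\<lambda>n. fps_nth F n * z ^ n) sums (f z - z + (\<Sum>i<2. fps_nth F i * z ^ i))"
      by (rule iffD1[OF sums_iff_shift])
    then show ?thesis by (simp add: F_def numeral_2_eq_2)
  qed
  moreover have "eventually (\<lambda>z::complex. z \<in> ball 0 1) (nhds 0)"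
    by (rule eventually_nhds_in_open) auto
  ultimately have "f has_fps_expansion F"
    by (intro has_fps_expansionI) (auto elim!: eventually_mono)
  then show ?thesis by (rule that) (simp_all add: F_def)
qed

text \<open>
  Here \<open>c\<^sub>1\<close> and \<open>c\<^sub>2\<close> are the coefficients of the function with positive real part that
  defines the class: averaging \<open>f(z)/z\<close> and \<open>f'(z)\<close> multiplies the coefficient of \<open>z\<^sup>k\<close> in
  \<open>f(z)/z\<close> by \<open>\<beta> + (1 - \<beta>)(k + 1) = 1 + k (1 - \<beta>)\<close>.
\<close>
lemma class_A_beta_coefficients:
  fixes \<beta> :: real
  assumes "\<beta> \<le> 1" and f: "f \<in> class_A_beta \<beta>"
  obtains c\<^sub>1 c\<^sub>2 :: complex
  where "taylor_coeff f 2 = c\<^sub>1 / of_real (2 - \<beta>)" "taylor_coeff f 3 = c\<^sub>2 / of_real (3 - 2 * \<beta>)"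
    "cmod (c\<^sub>2 - c\<^sub>1\<^sup>2 / 2) \<le> 2 - (cmod c\<^sub>1)\<^sup>2 / 2"
proof -
  have fA: "f \<in> class_A" and hol: "f holomorphic_on ball 0 1"
    and pos: "\<And>z. z \<in> ball 0 1 \<Longrightarrow>
      Re (of_real \<beta> * (if z = 0 then 1 else f z / z) + of_real (1 - \<beta>) * deriv f z) > 0"
    using f by (auto simp: class_A_beta_def class_A_def)
  obtain F where F: "f has_fps_expansion F" "fps_nth F 0 = 0" "fps_nth F 1 = 1"
    using class_A_has_fps_expansion[OF fA] .
  have f0: "f 0 = 0" and df0: "deriv f 0 = 1"
    using fps_nth_fps_expansion[OF F(1), of 0] fps_nth_fps_expansion[OF F(1), of 1] F by simp_all
  \<comment> \<open>\<open>g\<close> is \<open>f(z)/z\<close> with its removable singularity filled in.\<close>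
  obtain g where holg: "g holomorphic_on ball 0 1"
    and fg: "\<And>z. cmod z < 1 \<Longrightarrow> f z = z * g z" and g0: "deriv f 0 = g 0"
    using Schwarz3[OF hol f0] by blast
  define G where "G = fps_expansion g 0"
  have expg: "g has_fps_expansion G"
    unfolding G_def by (rule has_fps_expansion_fps_expansion[OF _ _ holg]) auto
  have "eventually (\<lambda>z::complex. z \<in> ball 0 1) (nhds 0)"
    by (rule eventually_nhds_in_open) auto
  then have "eventually (\<lambda>z. f z = z * g z) (nhds 0)"
    by (rule eventually_mono) (use fg in auto)
  moreover note F(1)
  moreover have "(\<lambda>z. z * g z) has_fps_expansion fps_X * G"
    by (intro fps_expansion_intros expg)
  ultimately have FG: "F = fps_X * G"
    by (rule fps_expansion_unique_ev)
  define p where "p = (\<lambda>z. of_real \<beta> * g z + of_real (1 - \<beta>) * deriv f z)"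
  define P where "P = fps_const (of_real \<beta>) * G + fps_const (of_real (1 - \<beta>)) * fps_deriv F"
  have expp: "p has_fps_expansion P"
    unfolding p_def P_def by (intro fps_expansion_intros expg F)
  have holp: "p holomorphic_on ball 0 1"
    unfolding p_def by (intro holomorphic_intros holg hol) auto
  have p0: "p 0 = 1"
    using g0 df0 by (simp add: p_def algebra_simps)
  have "p z = of_real \<beta> * (if z = 0 then 1 else f z / z) + of_real (1 - \<beta>) * deriv f z"
    if "z \<in> ball 0 1" for z
    using fg[of z] g0 df0 that by (auto simp: p_def)
  then have ppos: "Re (p z) > 0" if "z \<in> ball 0 1" for z
    using pos[OF that] that by metis
  have P: "fps_nth P n = fps_nth F (Suc n) * of_real (1 + real n * (1 - \<beta>))" for n
    by (simp add: P_def FG algebra_simps)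
  have nz: "2 - \<beta> \<noteq> 0" "3 - 2 * \<beta> \<noteq> 0" using assms(1) by auto
  have tc: "taylor_coeff f n = fps_nth F n" for n
    using fps_nth_fps_expansion[OF F(1)] by (simp add: taylor_coeff_def)
  have nz': "complex_of_real (2 - \<beta>) \<noteq> 0" "complex_of_real (3 - 2 * \<beta>) \<noteq> 0"
    using nz by (simp_all only: of_real_eq_0_iff not_False_eq_True)
  have P1: "fps_nth P 1 = fps_nth F 2 * of_real (2 - \<beta>)"
    using P[of 1] by (simp add: numeral_2_eq_2)
  have P2: "fps_nth P 2 = fps_nth F 3 * of_real (3 - 2 * \<beta>)"
    using P[of 2] by (simp add: numeral_3_eq_3 numeral_2_eq_2 algebra_simps)
  show ?thesis
  proof (rule that)
    show "taylor_coeff f 2 = fps_nth P 1 / of_real (2 - \<beta>)"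
      unfolding P1 tc using nz'(1) by simp
    show "taylor_coeff f 3 = fps_nth P 2 / of_real (3 - 2 * \<beta>)"
      unfolding P2 tc using nz'(2) by simp
    show "cmod (fps_nth P 2 - (fps_nth P 1)\<^sup>2 / 2) \<le> 2 - (cmod (fps_nth P 1))\<^sup>2 / 2"
      by (rule caratheodory_second_coefficient[OF holp p0 ppos expp])
  qed
qed

text \<open>
  The second argument of \<open>max\<close> is the value of \<open>(1 - y)\<^sup>2 - (y - s)\<^sup>2\<close>, with \<open>s = 2 / (3 - 2 \<beta>)\<close>,
  at the largest possible \<open>y = |a\<^sub>2|\<^sup>2\<close>, namely \<open>4 / (2 - \<beta>)\<^sup>2\<close>.
\<close>
lemma T31_le_max:
  fixes \<beta> :: real
  assumes "0 \<le> \<beta>" "\<beta> \<le> 1" and f: "f \<in> class_A_beta \<beta>"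
  shows "T31 f \<le> max 1 ((1 - 4 / (2 - \<beta>)\<^sup>2)\<^sup>2 - (4 / (2 - \<beta>)\<^sup>2 - 2 / (3 - 2 * \<beta>))\<^sup>2)"
proof -
  define m n where "m = 2 - \<beta>" and "n = 3 - 2 * \<beta>"
  have m: "1 \<le> m" and n: "1 \<le> n" "n = 2 * m - 1"
    using assms(1,2) by (auto simp: m_def n_def)
  obtain c\<^sub>1 c\<^sub>2 where a2: "taylor_coeff f 2 = c\<^sub>1 / of_real m"
    and a3: "taylor_coeff f 3 = c\<^sub>2 / of_real n"
    and c: "cmod (c\<^sub>2 - c\<^sub>1\<^sup>2 / 2) \<le> 2 - (cmod c\<^sub>1)\<^sup>2 / 2"
    using class_A_beta_coefficients[OF assms(2) f] unfolding m_def n_def .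
  define y d where "y = (cmod c\<^sub>1)\<^sup>2 / m\<^sup>2" and "d = cmod (taylor_coeff f 3 - (taylor_coeff f 2)\<^sup>2)"
  define s t where "s = 2 / n" and "t = 4 / m\<^sup>2"
  have T: "T31 f = (1 - y)\<^sup>2 - d\<^sup>2"
    unfolding T31_difference_of_squares d_def y_def a2 using m
    by (simp add: norm_divide power_divide)
  have c1: "(cmod c\<^sub>1)\<^sup>2 \<le> 4"
    using c norm_ge_zero[of "c\<^sub>2 - c\<^sub>1\<^sup>2 / 2"] by linarith
  have y: "0 \<le> y" "y \<le> t"
    using c1 by (auto simp: y_def t_def divide_right_mono)
  have s: "0 < s" "s \<le> 2" using n by (auto simp: s_def field_simps)
  have d: "y - s \<le> d"
  proof -
    have "(taylor_coeff f 2)\<^sup>2 - taylor_coeff f 3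
        = of_real (1 / m\<^sup>2 - 1 / (2 * n)) * c\<^sub>1\<^sup>2 - (c\<^sub>2 - c\<^sub>1\<^sup>2 / 2) / of_real n"
      unfolding a2 a3 using m n(1) by (simp add: field_simps)
    then have "cmod (of_real (1 / m\<^sup>2 - 1 / (2 * n)) * c\<^sub>1\<^sup>2) - cmod ((c\<^sub>2 - c\<^sub>1\<^sup>2 / 2) / of_real n) \<le> d"
      unfolding d_def by (metis norm_triangle_ineq2 norm_minus_commute)
    moreover have "cmod ((c\<^sub>2 - c\<^sub>1\<^sup>2 / 2) / of_real n) \<le> (2 - (cmod c\<^sub>1)\<^sup>2 / 2) / n"
      using c n(1) by (simp add: norm_divide divide_right_mono)
    moreover have "(1 / m\<^sup>2 - 1 / (2 * n)) * (cmod c\<^sub>1)\<^sup>2 \<le> cmod (of_real (1 / m\<^sup>2 - 1 / (2 * n)) * c\<^sub>1\<^sup>2)"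
      unfolding norm_mult norm_power norm_of_real by (intro mult_right_mono) auto
    moreover have "(1 / m\<^sup>2 - 1 / (2 * n)) * (cmod c\<^sub>1)\<^sup>2 - (2 - (cmod c\<^sub>1)\<^sup>2 / 2) / n = y - s"
      using m n(1) by (simp add: y_def s_def field_simps)
    ultimately show ?thesis by linarith
  qed
  have "T31 f \<le> max 1 ((1 - t)\<^sup>2 - (t - s)\<^sup>2)"
  proof (cases "y \<le> s")
    case True
    have "y * (2 - y) \<ge> 0" using True s y by simp
    then have "(1 - y)\<^sup>2 \<le> 1" by (simp add: power2_eq_square algebra_simps)
    then show ?thesis unfolding T using zero_le_power2[of d] by linarith
  next
    case False
    have "(y - s)\<^sup>2 \<le> d\<^sup>2" using d False by (intro power_mono) auto
    then have "T31 f \<le> (1 - y)\<^sup>2 - (y - s)\<^sup>2" unfolding T by simp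
    also have "\<dots> = (1 - s) * (1 + s - 2 * y)"
      by (simp add: power2_eq_square algebra_simps)
    \<comment> \<open>An affine function of \<open>y\<close> on \<open>[s, t]\<close>: its slope decides which end point gives the maximum.\<close>
    also have "\<dots> \<le> max 1 ((1 - s) * (1 + s - 2 * t))"
    proof (cases "s \<le> 1")
      case True
      have "(1 - s) * (1 + s - 2 * y) \<le> (1 - s) * (1 + s - 2 * s)"
        using True False by (intro mult_left_mono) auto
      also have "\<dots> \<le> 1 * 1"
        using True s by (intro mult_mono) auto
      finally show ?thesis by simp
    next
      case False
      then have "(1 - s) * (1 + s - 2 * y) \<le> (1 - s) * (1 + s - 2 * t)"
        using y by (intro mult_left_mono_neg) auto
      then show ?thesis by simp
    qed
    also have "(1 - s) * (1 + s - 2 * t) = (1 - t)\<^sup>2 - (t - s)\<^sup>2"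
      by (simp add: power2_eq_square algebra_simps)
    finally show ?thesis .
  qed
  then show ?thesis by (simp add: s_def t_def m_def n_def)
qed

section \<open>Extremal functions\<close>

lemma identity_in_class_A_beta: "(\<lambda>z. z) \<in> class_A_beta \<beta>"
proof -
  have "(\<lambda>n. (0::complex) * z ^ (n + 2)) sums (z - z)" for z :: complex
    by simp
  then have "(\<lambda>z. z) \<in> class_A"
    by (auto simp: class_A_def intro!: exI[of _ "\<lambda>_. 0"])
  moreover have "complex_of_real \<beta> * (if z = 0 then 1 else z / z) + of_real (1 - \<beta>) * deriv (\<lambda>z. z) z = 1"
    for z :: complex
    by simp
  ultimately show ?thesis
    unfolding class_A_beta_def by (simp only: mem_Collect_eq) simp
qed

lemma T31_identity: "T31 (\<lambda>z. z) = 1"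
proof -
  have "(\<lambda>z::complex. z) has_fps_expansion fps_X"
    by (intro fps_expansion_intros)
  then have "taylor_coeff (\<lambda>z. z) n = fps_nth fps_X n" for n
    using fps_nth_fps_expansion by (simp add: taylor_coeff_def)
  then show ?thesis
    by (simp add: T31_eq)
qed

text \<open>
  The extremal function is the one with \<open>\<beta> f(z)/z + (1 - \<beta>) f'(z) = (1 + z)/(1 - z)\<close>. All
  coefficients of the right-hand side after the first equal \<open>2\<close>, and solving for those of
  \<open>f\<close> gives \<open>a\<^sub>k\<^sub>+\<^sub>1 = 2 / (1 + k (1 - \<beta>))\<close> for \<open>k \<ge> 1\<close>.
\<close>
lemma half_plane_extremal:
  fixes \<beta> :: real
  assumes "\<beta> \<le> 1"
  obtains f where "f \<in> class_A_beta \<beta>"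
    "T31 f = (1 - 4 / (2 - \<beta>)\<^sup>2)\<^sup>2 - (4 / (2 - \<beta>)\<^sup>2 - 2 / (3 - 2 * \<beta>))\<^sup>2"
proof -
  define a :: "nat \<Rightarrow> real" where
    "a n = (if n = 0 then 0 else if n = 1 then 1 else 2 / (1 + (real n - 1) * (1 - \<beta>)))" for n
  define F :: "complex fps" where "F = Abs_fps (\<lambda>n. of_real (a n))"
  define f where "f = eval_fps F"
  have den: "1 + real n * (1 - \<beta>) \<ge> 1" for n
    using assms by simp
  have a_le: "\<bar>a n\<bar> \<le> 2" for n
  proof (cases n)
    case (Suc k)
    then show ?thesis using den[of k] by (auto simp: a_def divide_simps)
  qed (simp add: a_def)
  have radius: "fps_conv_radius F \<ge> 1"
    unfolding fps_conv_radius_def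
  proof (rule conv_radius_geI_ex')
    fix r :: real assume r: "0 < r" "ereal r < 1"
    have summable: "summable (\<lambda>n. 2 * r ^ n)"
      using r by (intro summable_mult summable_geometric) auto
    have bound: "cmod (fps_nth F n * of_real r ^ n) \<le> 2 * r ^ n" for n
      using a_le[of n] r by (simp add: F_def norm_mult norm_power mult_right_mono)
    show "summable (\<lambda>n. fps_nth F n * of_real r ^ n)"
      by (rule summable_comparison_test'[OF summable bound])
  qed
  have in_radius: "ereal (cmod z) < fps_conv_radius F" if "z \<in> ball 0 1" for z
    using that by (intro less_le_trans[OF _ radius]) simp
  have sums: "(\<lambda>n. of_real (a n) * z ^ n) sums f z" if "z \<in> ball 0 1" for z
    using sums_eval_fps[OF in_radius[OF that]] by (simp add: f_def F_def)
  have derivative: "deriv f z = eval_fps (fps_deriv F) z" if "z \<in> ball 0 1" for z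
    unfolding f_def by (intro DERIV_imp_deriv has_field_derivative_eval_fps in_radius that)
  have deriv_sums: "(\<lambda>n. of_real (real (Suc n) * a (Suc n)) * z ^ n) sums deriv f z"
    if "z \<in> ball 0 1" for z
    using sums_eval_fps[of z "fps_deriv F"] in_radius[OF that] fps_conv_radius_deriv[of F]
    by (simp add: derivative[OF that] F_def less_le_trans)
  have "f holomorphic_on ball 0 1"
    unfolding f_def using in_radius by (intro holomorphic_on_eval_fps) (auto simp: in_eball_iff)
  moreover have "(\<lambda>n. of_real (a (n + 2)) * z ^ (n + 2)) sums (f z - z)" if "z \<in> ball 0 1" for z
  proof -
    have "(\<lambda>n. of_real (a (n + 2)) * z ^ (n + 2)) sums (f z - (\<Sum>i<2. of_real (a i) * z ^ i))"
      by (rule sums_split_initial_segment[OF sums[OF that]])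
    then show ?thesis by (simp add: a_def numeral_2_eq_2)
  qed
  ultimately have fA: "f \<in> class_A"
    unfolding class_A_def by (auto intro!: exI[of _ "\<lambda>n. of_real (a n)"])
  have "Re (of_real \<beta> * (if z = 0 then 1 else f z / z) + of_real (1 - \<beta>) * deriv f z) > 0"
    if z: "z \<in> ball 0 1" for z
  proof -
    have quotient_sums: "(\<lambda>n. of_real (a (Suc n)) * z ^ n) sums (if z = 0 then 1 else f z / z)"
    proof (cases "z = 0")
      case True
      then show ?thesis using powser_sums_zero[of "\<lambda>n. complex_of_real (a (Suc n))"]
        by (simp add: a_def)
    next
      case False
      have "(\<lambda>n. of_real (a (Suc n)) * z ^ Suc n) sums f z"
        using sums[OF z] by (subst sums_Suc_iff) (simp add: a_def)
      from sums_divide[OF this, of z] show ?thesis using False by simp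
    qed
    have coeff: "\<beta> * a (Suc n) + (1 - \<beta>) * (real (Suc n) * a (Suc n)) = (if n = 0 then 1 else 2)" for n
    proof -
      have "\<beta> * a (Suc n) + (1 - \<beta>) * (real (Suc n) * a (Suc n)) = a (Suc n) * (1 + real n * (1 - \<beta>))"
        by (simp add: algebra_simps)
      moreover have "1 + real n * (1 - \<beta>) \<noteq> 0"
        using den[of n] by linarith
      then have "a (Suc n) * (1 + real n * (1 - \<beta>)) = (if n = 0 then 1 else 2)"
        unfolding a_def by (simp del: distrib_left_numeral)
      ultimately show ?thesis by (rule trans)
    qed
    have "(\<lambda>n. of_real \<beta> * (of_real (a (Suc n)) * z ^ n) + of_real (1 - \<beta>) * (of_real (real (Suc n) * a (Suc n)) * z ^ n))
      sums (of_real \<beta> * (if z = 0 then 1 else f z / z) + of_real (1 - \<beta>) * deriv f z)" (is "?u sums ?p")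
      by (intro sums_add sums_mult quotient_sums deriv_sums z)
    moreover have "?u = (\<lambda>n. of_real (if n = 0 then 1 else 2) * z ^ n)"
      unfolding coeff[symmetric] by (simp add: fun_eq_iff algebra_simps)
    ultimately have p: "(\<lambda>n. of_real (if n = 0 then 1 else 2) * z ^ n) sums ?p"
      by simp
    have "(\<lambda>n. 2 * z ^ n - (if n = 0 then 1 else 0)) sums (2 * (1 / (1 - z)) - 1)"
      using z by (intro sums_diff sums_mult geometric_sums sums_single) auto
    also have "(\<lambda>n. 2 * z ^ n - (if n = 0 then 1 else 0)) = (\<lambda>n. of_real (if n = 0 then 1 else 2) * z ^ n)"
      by auto
    finally have "?p = 2 * (1 / (1 - z)) - 1"
      by (rule sums_unique2[OF p])
    also have "\<dots> = (1 + z) / (1 - z)"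
    proof -
      have "1 - z \<noteq> 0" using z by auto
      then show ?thesis by (simp add: field_simps)
    qed
    also have "Re \<dots> = (1 - (cmod z)\<^sup>2) / (cmod (1 - z))\<^sup>2"
      unfolding Re_divide cmod_power2 by (simp add: power2_eq_square algebra_simps)
    also have "\<dots> > 0"
      using z by (intro divide_pos_pos) (auto simp: power_less_one_iff abs_square_less_1)
    finally show ?thesis .
  qed
  with fA have membership: "f \<in> class_A_beta \<beta>"
    by (simp add: class_A_beta_def)
  have "f has_fps_expansion F"
    unfolding f_def by (intro eval_fps_has_fps_expansion less_le_trans[OF _ radius]) simp
  then have "taylor_coeff f n = of_real (a n)" for n
    using fps_nth_fps_expansion[of f F n] by (simp add: taylor_coeff_def F_def)
  then have "T31 f = (1 - (cmod (of_real (a 2)))\<^sup>2)\<^sup>2 - (cmod (of_real (a 3) - (of_real (a 2))\<^sup>2))\<^sup>2"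
    unfolding T31_difference_of_squares by simp
  then have "T31 f = (1 - (a 2)\<^sup>2)\<^sup>2 - (a 3 - (a 2)\<^sup>2)\<^sup>2"
    unfolding of_real_power[symmetric] of_real_diff[symmetric] norm_of_real by simp
  moreover have "a 2 = 2 / (2 - \<beta>)" "a 3 = 2 / (3 - 2 * \<beta>)"
    by (simp_all add: a_def algebra_simps)
  ultimately have "T31 f = (1 - 4 / (2 - \<beta>)\<^sup>2)\<^sup>2 - (4 / (2 - \<beta>)\<^sup>2 - 2 / (3 - 2 * \<beta>))\<^sup>2"
    by (simp add: power_divide power2_commute[of "4 / _"])
  with membership show ?thesis by (rule that)
qed

section \<open>Comparison of the two extremal values\<close>

lemma extremal_value_eq:
  fixes \<beta> :: real
  assumes "\<beta> \<le> 1"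
  shows "(1 - 4 / (2 - \<beta>)\<^sup>2)\<^sup>2 - (4 / (2 - \<beta>)\<^sup>2 - 2 / (3 - 2 * \<beta>))\<^sup>2
    = (4 * \<beta> ^ 4 - 28 * \<beta> ^ 3 + 37 * \<beta> ^ 2 - 4 * \<beta> - 4) / ((3 - 2 * \<beta>) ^ 2 * (2 - \<beta>) ^ 2)"
    (is "?V = ?R")
proof -
  have nz: "2 - \<beta> \<noteq> 0" "3 - 2 * \<beta> \<noteq> 0" using assms by auto
  have "(1 - t)\<^sup>2 - (t - s)\<^sup>2 = (1 - s) * (1 + s - 2 * t)" for s t :: real
    by (simp add: power2_eq_square algebra_simps)
  then have "?V = (1 - 2 / (3 - 2 * \<beta>)) * (1 + 2 / (3 - 2 * \<beta>) - 2 * (4 / (2 - \<beta>)\<^sup>2))"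
    by blast
  also have "\<dots> = ((3 - 2 * \<beta>) - 2) * (((3 - 2 * \<beta>) + 2) * (2 - \<beta>)\<^sup>2 - 8 * (3 - 2 * \<beta>))
     / ((3 - 2 * \<beta>)\<^sup>2 * (2 - \<beta>)\<^sup>2)"
    using nz by (simp add: divide_simps) (simp add: power2_eq_square)
  also have "((3 - 2 * \<beta>) - 2) * (((3 - 2 * \<beta>) + 2) * (2 - \<beta>)\<^sup>2 - 8 * (3 - 2 * \<beta>))
     = 4 * \<beta> ^ 4 - 28 * \<beta> ^ 3 + 37 * \<beta> ^ 2 - 4 * \<beta> - 4"
    by (simp add: power2_eq_square power3_eq_cube power4_eq_xxxx algebra_simps)
  finally show ?thesis .
qed

text \<open>
  The factorisation exhibits the threshold: the larger root \<open>(10 + sqrt 10)/9\<close> exceeds \<open>1\<close>, so for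
  \<open>\<beta> \<le> 1\<close> the sign is that of \<open>\<beta> - (10 - sqrt 10)/9\<close>.
\<close>
lemma extremal_value_minus_one:
  fixes \<beta> :: real
  assumes "\<beta> \<le> 1"
  shows "(4 * \<beta> ^ 4 - 28 * \<beta> ^ 3 + 37 * \<beta> ^ 2 - 4 * \<beta> - 4) / ((3 - 2 * \<beta>) ^ 2 * (2 - \<beta>) ^ 2) - 1
    = 36 * (\<beta> - (10 - sqrt 10) / 9) * ((10 + sqrt 10) / 9 - \<beta>) / ((3 - 2 * \<beta>) ^ 2 * (2 - \<beta>) ^ 2)"
    (is "?N / ?D - 1 = ?E / ?D")
proof -
  have "?D \<noteq> 0" using assms by auto
  then have "?N / ?D - 1 = (?N - ?D) / ?D"
    by (simp add: diff_divide_distrib)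
  moreover have "sqrt 10 * sqrt 10 = 10" by simp
  then have "?N - ?D = ?E"
    by (simp add: power2_eq_square power3_eq_cube power4_eq_xxxx field_simps)
  ultimately show ?thesis by simp
qed

section \<open>The sharp bound\<close>

theorem theorem3p2:
  fixes \<beta> :: real
  assumes "0 \<le> \<beta>" and "\<beta> \<le> 1"
  shows "((10 - sqrt 10) / 9 \<le> \<beta> \<longrightarrow>
            (\<forall>f\<in>class_A_beta \<beta>.
               T31 f \<le> (4 * \<beta> ^ 4 - 28 * \<beta> ^ 3 + 37 * \<beta> ^ 2 - 4 * \<beta> - 4)
                         / ((3 - 2 * \<beta>) ^ 2 * (2 - \<beta>) ^ 2)) \<and>
            (\<exists>f\<in>class_A_beta \<beta>.
               T31 f = (4 * \<beta> ^ 4 - 28 * \<beta> ^ 3 + 37 * \<beta> ^ 2 - 4 * \<beta> - 4)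
                         / ((3 - 2 * \<beta>) ^ 2 * (2 - \<beta>) ^ 2)))
       \<and> (\<beta> \<le> (10 - sqrt 10) / 9 \<longrightarrow>
            (\<forall>f\<in>class_A_beta \<beta>. T31 f \<le> 1) \<and>
            (\<exists>f\<in>class_A_beta \<beta>. T31 f = 1))"
proof -
  define V where "V = (4 * \<beta> ^ 4 - 28 * \<beta> ^ 3 + 37 * \<beta> ^ 2 - 4 * \<beta> - 4)
                         / ((3 - 2 * \<beta>) ^ 2 * (2 - \<beta>) ^ 2)"
  have le: "T31 f \<le> max 1 V" if "f \<in> class_A_beta \<beta>" for f
    using T31_le_max[OF assms that] by (simp only: extremal_value_eq[OF assms(2)] V_def)
  obtain f\<^sub>0 where f0: "f\<^sub>0 \<in> class_A_beta \<beta>" "T31 f\<^sub>0 = V"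
    using half_plane_extremal[OF assms(2)] extremal_value_eq[OF assms(2)] V_def by metis
  have "(10 + x) / 9 - \<beta> \<ge> 0" if "0 \<le> x" for x :: real
    using that assms(2) by (simp add: field_simps)
  then have root: "(10 + sqrt 10) / 9 - \<beta> \<ge> 0" by simp
  have V: "V - 1 = 36 * (\<beta> - (10 - sqrt 10) / 9) * ((10 + sqrt 10) / 9 - \<beta>)
      / ((3 - 2 * \<beta>) ^ 2 * (2 - \<beta>) ^ 2)"
    unfolding V_def by (rule extremal_value_minus_one[OF assms(2)])
  have ge: "V \<ge> 1" if "(10 - sqrt 10) / 9 \<le> \<beta>"
  proof -
    have "V - 1 \<ge> 0" unfolding V using root that
      by (intro divide_nonneg_nonneg mult_nonneg_nonneg) auto
    then show ?thesis by simp
  qed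
  have le1: "V \<le> 1" if "\<beta> \<le> (10 - sqrt 10) / 9"
  proof -
    have "V - 1 \<le> 0" unfolding V using root that
      by (intro divide_nonpos_nonneg mult_nonpos_nonneg mult_nonneg_nonpos) auto
    then show ?thesis by simp
  qed
  have upper: "(\<forall>f\<in>class_A_beta \<beta>. T31 f \<le> V) \<and> (\<exists>f\<in>class_A_beta \<beta>. T31 f = V)"
    if "(10 - sqrt 10) / 9 \<le> \<beta>"
    using le f0 ge[OF that] by (auto simp: max_def split: if_splits)
  have lower: "(\<forall>f\<in>class_A_beta \<beta>. T31 f \<le> 1) \<and> (\<exists>f\<in>class_A_beta \<beta>. T31 f = 1)"
    if "\<beta> \<le> (10 - sqrt 10) / 9"
    using le le1[OF that] identity_in_class_A_beta T31_identity by fastforce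
  show ?thesis using upper lower unfolding V_def by blast
qed

end
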